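(* Let $K$ be an algebraically closed field of characteristic $0$, let $A\in M_n(K)$ be diagonalizable over $K$, and let $X\in M_n(K)$ be a solution of $XA-AX=X^2-X^3$. Let $B_1,\dots,B_k$ be lists decomposing the complete spectrum of $A$ as described in the context, with $B_r=\{L_{r,c_r},\dots,L_{r,1},L_{r,0}\}$, let $U_r=\mathrm{diag}(B_r)$, and let $P$ be an invertible matrix such that $P^{-1}AP=\bigoplus_{r=1}^k U_r$. Then $$P^{-1}XP=\bigoplus_{r=1}^k X_r\quad\text{where, for every } r,\quad X_rU_r-U_rX_r=X_r^2-X_r^3 .$$ Moreover, for every $r$, with respect to the block structure associated with the decomposition of $B_r$ into the lists $L_{r,c_r},\dots,L_{r,1},L_{r,0}$ (in this order), $X_r$ is an upper triangular block-matrix whose diagonal blocks are, in order, $Y_{r,c_r},\dots,Y_{r,1},Y_{r,0}$, and they satisfy, for every $0\leq i\leq c_r$, $Y_{r,i}^2-Y_{r,i}^3=0$.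
   Context: The complete spectrum $\sigma(A)$ of $A$ is the list of its eigenvalues counted with multiplicity. It can be written as $\sigma(A)=\bigcup_{r=1}^k B_r$, where the $B_r$ are lists satisfying: (a) for every $r$ there exist $\lambda_r\in K$ and a nonnegative integer $c_r$ such that $B_r=\{L_{r,c_r},\dots,L_{r,1},L_{r,0}\}$ (ordered concatenation), where for every $0\leq i\leq c_r$ the list $L_{r,i}$ consists of the eigenvalue $\lambda_r+i$ of $A$ repeated according to its multiplicity as an eigenvalue of $A$; (b) if $r\neq s$, $u\in B_r$ and $v\in B_s$, then $u-v\neq 1$. The eigenvalues of $A$ are ordered according to the sequence $B_1,\dots,B_k$; $\mathrm{diag}(B_r)$ is the diagonal matrix whose diagonal entries are the elements of the list $B_r$ in order, and $\bigoplus$ denotes block-diagonal direct sum of matrices. $X_r$ is a square matrix of the same size as $U_r$, and $Y_{r,i}$ is square of size the length of $L_{r,i}$. *)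

theory Defs
  imports "Jordan_Normal_Form.Char_Poly"
begin

definition diagonalizable_mat :: "'a::comm_ring_1 mat \<Rightarrow> bool" where
  "diagonalizable_mat A \<longleftrightarrow> (\<exists>D. similar_mat A D \<and> diagonal_mat D)"

definition spectrum_mset :: "'a::idom mat \<Rightarrow> 'a multiset" where
  "spectrum_mset A = proots (char_poly A)"

definition eigen_list :: "'a::idom mat \<Rightarrow> 'a \<Rightarrow> 'a list" where
  "eigen_list A \<mu> = replicate (order \<mu> (char_poly A)) \<mu>"

(* The lists for lam + c, ..., lam + 1, lam, in this decreasing order. *)
definition chain_lists :: "'a::idom mat \<Rightarrow> 'a \<Rightarrow> nat \<Rightarrow> 'a list list" where
  "chain_lists A lam c = map (\<lambda>i. eigen_list A (lam + of_nat i)) (rev [0..<Suc c])"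

definition chain_list :: "'a::idom mat \<Rightarrow> 'a \<Rightarrow> nat \<Rightarrow> 'a list" where
  "chain_list A lam c = concat (chain_lists A lam c)"

definition spectrum_decomposition ::
    "'a::field mat \<Rightarrow> nat \<Rightarrow> (nat \<Rightarrow> 'a) \<Rightarrow> (nat \<Rightarrow> nat) \<Rightarrow> (nat \<Rightarrow> 'a list) \<Rightarrow> bool" where
  "spectrum_decomposition A k lam c B \<longleftrightarrow>
     spectrum_mset A = (\<Sum>r<k. mset (B r)) \<and>
     (\<forall>r<k. (\<forall>i\<le>c r. eigenvalue A (lam r + of_nat i)) \<and> B r = chain_list A (lam r) (c r)) \<and>
     (\<forall>r<k. \<forall>s<k. r \<noteq> s \<longrightarrow> (\<forall>u\<in>set (B r). \<forall>v\<in>set (B s). u - v \<noteq> 1))"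

definition diag_of_list :: "'a::zero list \<Rightarrow> 'a mat" where
  "diag_of_list xs = mat_diag (length xs) (\<lambda>i. xs ! i)"

(* Blocks of a square matrix partitioned, in rows and in columns, according to the list of
   sizes ds; both block indices start at 0. *)
definition mat_block :: "nat list \<Rightarrow> 'a mat \<Rightarrow> nat \<Rightarrow> nat \<Rightarrow> 'a mat" where
  "mat_block ds M p q = mat (ds ! p) (ds ! q)
     (\<lambda>(i, j). M $$ (sum_list (take p ds) + i, sum_list (take q ds) + j))"

definition block_upper_triangular :: "nat list \<Rightarrow> 'a::zero mat \<Rightarrow> bool" where
  "block_upper_triangular ds M \<longleftrightarrow>
     M \<in> carrier_mat (sum_list ds) (sum_list ds) \<and>
     (\<forall>p<length ds. \<forall>q<p. mat_block ds M p q = 0\<^sub>m (ds ! p) (ds ! q))"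

definition diag_blocks :: "nat list \<Rightarrow> 'a mat \<Rightarrow> 'a mat list" where
  "diag_blocks ds M = map (\<lambda>p. mat_block ds M p p) [0..<length ds]"

end

theory Submission
  imports Defs
begin

text \<open>
  Put $Y = P^{-1}XP$ and $D = P^{-1}AP$, a diagonal matrix with entries $d_0, \dots, d_{n-1}$, so that
  $YD - DY = Y^2 - Y^3$. The whole statement follows from one fact about single entries
  (lemma \<open>entries_linked\<close>): if $Y_{ij} \neq 0$, then $d_i = d_j + l$ for a natural number $l$, and
  every one of $d_j, d_j + 1, \dots, d_j + l$ is an eigenvalue.

  To see this, fix $j$ and let $\varphi_i(p)$ be the entry of $p(Y)$ at $(i, j)$. Since
  $Y^k D - D Y^k = k (Y^{k+1} - Y^{k+2})$, these linear functionals on $K[t]$ are eigenvectors of the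
  transpose of the derivation $\Delta = t^2(t-1)\,d/dt$:
  $\varphi_i(\Delta p) = (d_i - d_j)\,\varphi_i(p)$. Their common kernel is a nonzero ideal that is
  stable under $\Delta$. A generator $m$ of it divides $t^2(t-1)m'$. In characteristic $0$ a root of $m$
  of multiplicity $e$ is a root of $m'$ of multiplicity $e - 1$, so it must be $0$ or $1$, and
  $m = t^a(t-1)^b$ up to a unit. On $K[t]/(m)$ the derivation $\Delta$ raises the order of vanishing
  at $0$, and acts as multiplication by $l$ on $t^a(t-1)^l$ modulo $t^a(t-1)^{l+1}$. Therefore
  $d_i - d_j$ is $0$ or one of $0, \dots, b - 1$ whenever $\varphi_i \neq 0$ (\<open>eigenvalue_cases\<close>), and
  each of $0, \dots, b - 1$ is attained (\<open>eigenvalue_attained\<close>).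

  The relation between $d_i$ and $d_j$ obtained in this way is transitive and antisymmetric. The lists
  $B_r$ have no value in common, and values of different lists do not differ by $1$, so the relation
  stays inside one list. Hence $Y$ is block diagonal,
  and its blocks are block upper triangular because each $B_r$ lists its values in decreasing order.
  Matrices whose nonzero entries respect a transitive relation are closed under multiplication, and
  restriction to an interval of indices that is convex for the relation is multiplicative on them
  (\<open>principal_block_mult\<close>). This restricts the equation to the blocks $X_r$, and again to the
  blocks $Y_{r,i}$, where $D$ is scalar and the commutator vanishes.
\<close>

section \<open>The derivation $t^2(t-1)\,d/dt$ on polynomials\<close>

(* From here on smult is scalar multiplication of polynomials. *)
hide_const (open) module.smult

text \<open>The derivation $\Delta p = t^2(t-1)p'$, with $t$ written as \<open>[:0, 1:]\<close> and $t - 1$ as \<open>[:-1, 1:]\<close>.\<close>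

definition cubic_deriv :: "'a::field_char_0 poly \<Rightarrow> 'a poly" where
  "cubic_deriv p = [:0, 1:] ^ 2 * [:-1, 1:] * pderiv p"

lemma cubic_deriv_factor:
  fixes q :: "'a::field_char_0 poly"
  shows "cubic_deriv ([:0, 1:] ^ a * [:-1, 1:] ^ j * q) =
    [:0, 1:] ^ a * [:-1, 1:] ^ j *
      (smult (of_nat a) ([:0, 1:] * [:-1, 1:] * q) + smult (of_nat j) ([:0, 1:] ^ 2 * q)
        + [:0, 1:] ^ 2 * [:-1, 1:] * pderiv q)"
proof -
  have pow: "r * pderiv (r ^ k) = smult (of_nat k) (r ^ k * pderiv r)" for r :: "'a poly" and k
    by (cases k) (simp_all add: pderiv_power_Suc del: power_Suc, simp add: algebra_simps)
  define t s :: "'a poly" where "t = [:0, 1:]" and "s = [:-1, 1:]"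
  have ta: "t * pderiv (t ^ a) = smult (of_nat a) (t ^ a)"
    and sj: "s * pderiv (s ^ j) = smult (of_nat j) (s ^ j)"
    using pow[of t a] pow[of s j] by (simp_all add: t_def s_def pderiv_pCons one_pCons[symmetric])
  have "t ^ 2 * s * pderiv (t ^ a * s ^ j * q) =
      t * s * s ^ j * q * (t * pderiv (t ^ a)) + t ^ 2 * t ^ a * q * (s * pderiv (s ^ j))
      + t ^ 2 * s * t ^ a * s ^ j * pderiv q"
    by (simp add: pderiv_mult algebra_simps power2_eq_square)
  also have "\<dots> = t ^ a * s ^ j *
      (smult (of_nat a) (t * s * q) + smult (of_nat j) (t ^ 2 * q) + t ^ 2 * s * pderiv q)"
    unfolding ta sj by (simp add: algebra_simps)
  finally show ?thesis by (simp add: cubic_deriv_def t_def s_def)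
qed

text \<open>
  On $t^a(t-1)^jK[t]$ the derivation acts as multiplication by $j$ modulo $t^a(t-1)^{j+1}K[t]$,
  because $t^2 \equiv 1$ modulo $t - 1$.
\<close>

lemma cubic_deriv_at_one:
  fixes q :: "'a::field_char_0 poly"
  shows "\<exists>h. cubic_deriv ([:0, 1:] ^ a * [:-1, 1:] ^ j * q) =
    smult (of_nat j) ([:0, 1:] ^ a * [:-1, 1:] ^ j * q) + [:0, 1:] ^ a * [:-1, 1:] ^ Suc j * h"
proof -
  define t s :: "'a poly" where "t = [:0, 1:]" and "s = [:-1, 1:]"
  have t2: "t ^ 2 = 1 + s * (t + 1)"
    by (simp add: t_def s_def power2_eq_square one_pCons)
  have expand: "smult (of_nat a) (t * s * q) + smult (of_nat j) (t ^ 2 * q) + t ^ 2 * s * pderiv q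
     = smult (of_nat j) q + s * (smult (of_nat a) (t * q) + smult (of_nat j) ((t + 1) * q)
        + t ^ 2 * pderiv q)"
    by (subst t2) (simp add: algebra_simps smult_add_right)
  show ?thesis
    unfolding cubic_deriv_factor unfolding t_def[symmetric] s_def[symmetric] expand
    by (intro exI[of _ "smult (of_nat a) (t * q) + smult (of_nat j) ((t + 1) * q)
        + t ^ 2 * pderiv q"]) (simp add: algebra_simps)
qed

lemma cubic_deriv_at_zero:
  fixes q :: "'a::field_char_0 poly"
  shows "\<exists>h. cubic_deriv ([:0, 1:] ^ a * q) = [:0, 1:] ^ Suc a * h"
proof -
  define t s :: "'a poly" where "t = [:0, 1:]" and "s = [:-1, 1:]"
  have "cubic_deriv (t ^ a * q) = t ^ a * (smult (of_nat a) (t * s * q) + t ^ 2 * s * pderiv q)"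
    using cubic_deriv_factor[of a 0 q] by (simp add: t_def s_def)
  then show ?thesis
    unfolding t_def[symmetric] s_def[symmetric]
    by (intro exI[of _ "smult (of_nat a) (s * q) + t * s * pderiv q"])
      (simp add: algebra_simps power2_eq_square)
qed

text \<open>
  If $m \neq 0$ divides $t^2(t-1)m'$, then $m$ has no roots other than $0$ and $1$: at any other root
  the order of $t^2(t-1)m'$ is one less than that of $m$.
\<close>

lemma cubic_deriv_dvd_imp_factor:
  fixes m :: "'a::{alg_closed_field, field_char_0} poly"
  assumes m0: "m \<noteq> 0" and dvd: "m dvd cubic_deriv m"
  shows "\<exists>u a b. u \<noteq> 0 \<and> m = smult u ([:0, 1:] ^ a * [:-1, 1:] ^ b)"
proof -
  obtain g where g: "m = [:0, 1:] ^ order 0 m * g" "\<not> [:0, 1:] dvd g"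
    using order_decomp[OF m0, of 0] by auto
  have g0: "g \<noteq> 0" using g by auto
  obtain h where h: "g = [:-1, 1:] ^ order 1 g * h" "\<not> [:-1, 1:] dvd h"
    using order_decomp[OF g0, of 1] by auto
  have h0: "h \<noteq> 0" using h by auto
  have "degree h = 0"
  proof (rule ccontr)
    assume "degree h \<noteq> 0"
    then obtain x where x: "poly h x = 0" using alg_closed_imp_poly_has_root[of h] by auto
    have hm: "h dvd m" and hg: "h dvd g" using g(1) h(1) by (metis dvd_triv_right dvd_mult)+
    have x1: "x \<noteq> 1" using h(2) x poly_eq_0_iff_dvd by blast
    have "x \<noteq> 0"
    proof
      assume "x = 0"
      with x hg have "poly g 0 = 0" by (auto elim!: dvdE)
      with g(2) show False using poly_eq_0_iff_dvd[of g 0] by simp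
    qed
    have mx: "poly m x = 0" using x hm by (auto elim!: dvdE)
    have "\<not> (\<exists>c. m = [:c:])" using mx m0 by auto
    then have m': "pderiv m \<noteq> 0" by (metis degree_eq_zeroE pderiv_eq_0_iff)
    have nz: "[:0, 1:] ^ 2 * [:-1, 1:] * pderiv m \<noteq> 0"
      using m' by (simp only: mult_eq_0_iff power_eq_0_iff pCons_eq_0_iff) simp
    have t0: "order x ([:0, 1:] ^ 2 * [:-1, 1:]) = 0"
      using \<open>x \<noteq> 0\<close> x1 by (intro order_0I) simp
    have "order x m \<le> order x (cubic_deriv m)"
      using dvd nz unfolding cubic_deriv_def by (intro dvd_imp_order_le)
    also have "\<dots> = order x (pderiv m)"
      unfolding cubic_deriv_def order_mult[OF nz] t0 by simp
    also have "\<dots> < order x m" using order_pderiv[OF m0 mx] by simp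
    finally show False by simp
  qed
  then obtain u where u: "h = [:u:]" by (elim degree_eq_zeroE)
  have "m = smult u ([:0, 1:] ^ order 0 m * [:-1, 1:] ^ order 1 g)"
    by (subst g(1), subst h(1)) (simp add: u)
  moreover have "u \<noteq> 0" using h0 u by simp
  ultimately show ?thesis by blast
qed

section \<open>Functionals that are eigenvectors of the derivation\<close>

text \<open>
  A finite family of linear functionals \<open>\<phi> i\<close> on $K[t]$ with
  $\varphi_i(\Delta p) = \delta_i\,\varphi_i(p)$. The assumption \<open>shift\<close> says that their common kernel
  is stable under multiplication by $t$, which makes it an ideal.
\<close>

locale cubic_eigenfunctionals =
  fixes I :: "'i set" and \<phi> :: "'i \<Rightarrow> 'a::{alg_closed_field, field_char_0} poly \<Rightarrow> 'a"
    and \<delta> :: "'i \<Rightarrow> 'a"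
  assumes finite: "finite I"
    and add: "\<And>i p q. i \<in> I \<Longrightarrow> \<phi> i (p + q) = \<phi> i p + \<phi> i q"
    and smult: "\<And>i u p. i \<in> I \<Longrightarrow> \<phi> i (smult u p) = u * \<phi> i p"
    and eigen: "\<And>i p. i \<in> I \<Longrightarrow> \<phi> i (cubic_deriv p) = \<delta> i * \<phi> i p"
    and shift: "\<And>i p. (\<And>k. k \<in> I \<Longrightarrow> \<phi> k p = 0) \<Longrightarrow> i \<in> I \<Longrightarrow> \<phi> i (pCons 0 p) = 0"
begin

text \<open>The common kernel of the functionals.\<close>

definition annihilator :: "'a poly set" where
  "annihilator = {p. \<forall>i\<in>I. \<phi> i p = 0}"

lemma zero: "i \<in> I \<Longrightarrow> \<phi> i 0 = 0"
  using smult[of i 0 0] by simp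

lemma diff: "i \<in> I \<Longrightarrow> \<phi> i (p - q) = \<phi> i p - \<phi> i q"
  using add[of i "p - q" q] by simp

lemma annihilator_mult: "p \<in> annihilator \<Longrightarrow> q * p \<in> annihilator"
proof (induction q)
  case 0
  then show ?case by (simp add: annihilator_def zero)
next
  case (pCons c q)
  then have "q * p \<in> annihilator" by simp
  then have "pCons 0 (q * p) \<in> annihilator" unfolding annihilator_def using shift by auto
  with pCons.prems show ?case by (simp add: annihilator_def add smult)
qed

lemma annihilator_diff: "p \<in> annihilator \<Longrightarrow> q \<in> annihilator \<Longrightarrow> p - q \<in> annihilator"
  by (simp add: annihilator_def diff)

lemma cubic_deriv_annihilator: "p \<in> annihilator \<Longrightarrow> cubic_deriv p \<in> annihilator"
  by (simp add: annihilator_def eigen)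

text \<open>
  Finitely many functionals have a nonzero common zero. For the induction on their number this is
  strengthened to zeros of arbitrarily large degree: two zeros of different degrees can be combined
  to kill one more functional, without cancelling the leading term of larger degree.
\<close>

lemma annihilator_nonzero: "\<exists>p\<in>annihilator. p \<noteq> 0"
proof -
  have "\<exists>p. degree p \<ge> N \<and> p \<noteq> 0 \<and> (\<forall>i\<in>J. \<phi> i p = 0)" if "finite J" "J \<subseteq> I" for J N
    using that
  proof (induction J arbitrary: N rule: finite_induct)
    case empty
    show ?case by (rule exI[of _ "monom 1 N"]) (simp add: degree_monom_eq)
  next
    case (insert j J)
    then have jI: "j \<in> I" and JI: "J \<subseteq> I" by auto
    from insert.IH[OF JI, of N] obtain p
      where p: "degree p \<ge> N" "p \<noteq> 0" "\<forall>i\<in>J. \<phi> i p = 0" by auto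
    from insert.IH[OF JI, of "Suc (degree p)"] obtain q
      where q: "degree q > degree p" "\<forall>i\<in>J. \<phi> i q = 0" by (auto simp: Suc_le_eq)
    show ?case
    proof (cases "\<phi> j p = 0")
      case True
      with p show ?thesis by auto
    next
      case False
      define w where "w = smult (\<phi> j p) q - smult (\<phi> j q) p"
      have "degree (smult (\<phi> j q) p) < degree (smult (\<phi> j p) q)"
        using q(1) False degree_smult_le[of "\<phi> j q" p] by simp
      then have "degree w = degree q"
        using False by (simp add: w_def diff_conv_add_uminus degree_add_eq_left del: add_uminus_conv_diff)
      moreover have "\<phi> i w = 0" if "i \<in> insert j J" for i
        using that p q jI JI by (auto simp: w_def diff smult)
      ultimately show ?thesis using p q by (intro exI[of _ w]) auto
    qed
  qed
  from this[OF finite, of 0] show ?thesis by (auto simp: annihilator_def)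
qed

lemma annihilator_generator:
  "\<exists>a b. \<forall>p. p \<in> annihilator \<longleftrightarrow> [:0, 1:] ^ a * [:-1, 1:] ^ b dvd p"
proof -
  have "\<exists>p. p \<in> annihilator \<and> p \<noteq> 0" using annihilator_nonzero by auto
  \<comment> \<open>A nonzero element of least degree generates the ideal, by division with remainder.\<close>
  from exists_least_iff[of "\<lambda>n. \<exists>p. p \<in> annihilator \<and> p \<noteq> 0 \<and> degree p = n"] this
  obtain m where m: "m \<in> annihilator" "m \<noteq> 0"
    and least: "\<And>p. p \<in> annihilator \<Longrightarrow> p \<noteq> 0 \<Longrightarrow> degree m \<le> degree p"
    by (metis not_le)
  have gen: "p \<in> annihilator \<longleftrightarrow> m dvd p" for p
  proof
    assume p: "p \<in> annihilator"
    have "p - p div m * m \<in> annihilator" by (intro annihilator_diff p annihilator_mult m)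
    then have "p mod m \<in> annihilator" by (simp add: minus_div_mult_eq_mod)
    then have "p mod m = 0" using least[of "p mod m"] degree_mod_less[OF m(2), of p] by force
    then show "m dvd p" by auto
  next
    assume "m dvd p"
    then show "p \<in> annihilator" using annihilator_mult[OF m(1)] by (auto simp: mult.commute elim!: dvdE)
  qed
  have "m dvd cubic_deriv m" using gen m cubic_deriv_annihilator by blast
  from cubic_deriv_dvd_imp_factor[OF m(2) this] obtain u a b
    where "u \<noteq> 0" "m = smult u ([:0, 1:] ^ a * [:-1, 1:] ^ b)" by blast
  then have "p \<in> annihilator \<longleftrightarrow> [:0, 1:] ^ a * [:-1, 1:] ^ b dvd p" for p
    unfolding gen by (simp add: smult_dvd_iff)
  then show ?thesis by blast
qed

text \<open>
  If $\delta_i$ is none of the eigenvalues of $\Delta$ on $K[t]/(t^a(t-1)^b)$, then $\varphi_i$ vanishes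
  on all members of the filtration
  $(t^a(t-1)^b) \subseteq \dots \subseteq (t^a(t-1)) \subseteq (t^a) \subseteq \dots \subseteq (1)$.
\<close>

lemma eigenvalue_cases:
  assumes gen: "\<And>p. p \<in> annihilator \<longleftrightarrow> [:0, 1:] ^ a * [:-1, 1:] ^ b dvd p"
    and i: "i \<in> I" and nz: "\<phi> i p \<noteq> 0"
  shows "\<delta> i = 0 \<or> (\<exists>l<b. \<delta> i = of_nat l)"
proof (rule ccontr)
  assume "\<not> ?thesis"
  then have d0: "\<delta> i \<noteq> 0" and dl: "\<And>l. l < b \<Longrightarrow> \<delta> i \<noteq> of_nat l" by auto
  have one: "\<phi> i ([:0, 1:] ^ a * [:-1, 1:] ^ j * q) = 0" if "j \<le> b" for j q
    using that
  proof (induction arbitrary: q rule: inc_induct)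
    case base
    have "[:0, 1:] ^ a * [:-1, 1:] ^ b * q \<in> annihilator" by (simp add: gen)
    then show ?case using i by (simp add: annihilator_def)
  next
    case (step j)
    obtain h where h: "cubic_deriv ([:0, 1:] ^ a * [:-1, 1:] ^ j * q) =
        smult (of_nat j) ([:0, 1:] ^ a * [:-1, 1:] ^ j * q) + [:0, 1:] ^ a * [:-1, 1:] ^ Suc j * h"
      using cubic_deriv_at_one by blast
    from arg_cong[OF h, of "\<phi> i"] step.IH[of h]
    have "(\<delta> i - of_nat j) * \<phi> i ([:0, 1:] ^ a * [:-1, 1:] ^ j * q) = 0"
      by (simp add: eigen[OF i] add[OF i] smult[OF i] algebra_simps del: power_Suc)
    with dl[OF step.hyps(2)] show ?case by simp
  qed
  have "\<phi> i ([:0, 1:] ^ j * q) = 0" if "j \<le> a" for j q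
    using that
  proof (induction arbitrary: q rule: inc_induct)
    case base
    show ?case using one[of 0 q] by simp
  next
    case (step j)
    obtain h where h: "cubic_deriv ([:0, 1:] ^ j * q) = [:0, 1:] ^ Suc j * h"
      using cubic_deriv_at_zero by blast
    from arg_cong[OF h, of "\<phi> i"] step.IH[of h]
    have "\<delta> i * \<phi> i ([:0, 1:] ^ j * q) = 0" by (simp add: eigen[OF i] del: power_Suc)
    with d0 show ?case by simp
  qed
  from this[of 0 p] nz show False by simp
qed

text \<open>
  The leading term $t^a(t-1)^j$ can be corrected step by step to an eigenvector of $\Delta$ on
  $K[t]/(t^a(t-1)^b)$ with eigenvalue $j$. It is nonzero in this quotient, hence some $\varphi_i$
  does not vanish on it, and then $\delta_i = j$.
\<close>

lemma eigenvalue_attained: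
  assumes gen: "\<And>p. p \<in> annihilator \<longleftrightarrow> [:0, 1:] ^ a * [:-1, 1:] ^ b dvd p"
    and j: "j < b"
  shows "\<exists>i\<in>I. \<delta> i = of_nat j"
proof (rule ccontr)
  assume neg: "\<not> ?thesis"
  define t s :: "'a poly" where "t = [:0, 1:]" and "s = [:-1, 1:]"
  have "\<exists>g h. cubic_deriv (t ^ a * s ^ j * (1 + s * g)) =
      smult (of_nat j) (t ^ a * s ^ j * (1 + s * g)) + t ^ a * s ^ l * h" if "Suc j \<le> l" for l
    using that
  proof (induction l rule: dec_induct)
    case base
    obtain h where "cubic_deriv (t ^ a * s ^ j * 1) =
        smult (of_nat j) (t ^ a * s ^ j * 1) + t ^ a * s ^ Suc j * h"
      using cubic_deriv_at_one[of a j 1] unfolding t_def s_def by blast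
    then show ?case by (intro exI[of _ 0] exI[of _ h]) simp
  next
    case (step l)
    then obtain g h where gh: "cubic_deriv (t ^ a * s ^ j * (1 + s * g)) =
      smult (of_nat j) (t ^ a * s ^ j * (1 + s * g)) + t ^ a * s ^ l * h" by blast
    \<comment> \<open>Adding $t^a(t-1)^l v$ changes the error by $(l-j)\,t^a(t-1)^l v$ modulo $t^a(t-1)^{l+1}$.\<close>
    define v where "v = smult (- 1 / of_nat (l - j)) h"
    have lj: "of_nat (l - j) \<noteq> (0::'a)" using step.hyps by simp
    have hv: "h = - smult (of_nat l - of_nat j) v"
      using lj step.hyps by (simp add: v_def of_nat_diff)
    obtain w where w: "cubic_deriv (t ^ a * s ^ l * v) =
        smult (of_nat l) (t ^ a * s ^ l * v) + t ^ a * s ^ Suc l * w"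
      using cubic_deriv_at_one[of a l v] unfolding t_def s_def by blast
    define g' where "g' = g + s ^ (l - Suc j) * v"
    have "s ^ l = s ^ j * s * s ^ (l - Suc j)"
      using step.hyps by (simp add: power_add[symmetric] power_Suc2[symmetric] del: power_Suc)
    then have split: "t ^ a * s ^ j * (1 + s * g') = t ^ a * s ^ j * (1 + s * g) + t ^ a * s ^ l * v"
      by (simp add: g'_def algebra_simps)
    have der: "cubic_deriv (p + q) = cubic_deriv p + cubic_deriv q" for p q :: "'a poly"
      by (simp add: cubic_deriv_def pderiv_add algebra_simps)
    have "cubic_deriv (t ^ a * s ^ j * (1 + s * g')) =
      smult (of_nat j) (t ^ a * s ^ j * (1 + s * g')) + t ^ a * s ^ Suc l * w"
      unfolding split der gh w hv
      by (simp add: smult_add_right smult_diff_left algebra_simps)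
    then show ?case by blast
  qed
  from this[of b] j obtain g h where gh: "cubic_deriv (t ^ a * s ^ j * (1 + s * g)) =
      smult (of_nat j) (t ^ a * s ^ j * (1 + s * g)) + t ^ a * s ^ b * h" by auto
  have ann: "t ^ a * s ^ b * h \<in> annihilator" by (simp add: gen t_def s_def)
  have "\<phi> i (t ^ a * s ^ j * (1 + s * g)) = 0" if i: "i \<in> I" for i
  proof -
    have "(\<delta> i - of_nat j) * \<phi> i (t ^ a * s ^ j * (1 + s * g)) = 0"
      using arg_cong[OF gh, of "\<phi> i"] ann i
      by (simp add: eigen add smult annihilator_def algebra_simps)
    then show ?thesis using neg i by auto
  qed
  then have "t ^ a * s ^ b dvd t ^ a * s ^ j * (1 + s * g)"
    using gen unfolding annihilator_def t_def s_def by blast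
  moreover have "t ^ a * s ^ Suc j dvd t ^ a * s ^ b"
    using j by (intro mult_dvd_mono dvd_refl le_imp_power_dvd) simp
  ultimately have "t ^ a * s ^ j * s dvd t ^ a * s ^ j * (1 + s * g)"
    unfolding power_Suc2 mult.assoc by (rule dvd_trans[rotated])
  moreover have "t ^ a * s ^ j \<noteq> 0" by (simp add: t_def s_def)
  ultimately have "s dvd 1 + s * g" unfolding dvd_mult_cancel_left by blast
  then have "s dvd 1" by (simp only: dvd_add_left_iff[OF dvd_triv_left])
  then have "poly 1 (1::'a) = 0" unfolding s_def poly_eq_0_iff_dvd by simp
  then show False by simp
qed

lemma eigenvalue_chain:
  assumes "i \<in> I" and "\<phi> i p \<noteq> 0"
  shows "\<exists>l. \<delta> i = of_nat l \<and> (\<forall>j\<le>l. j = 0 \<or> (\<exists>i'\<in>I. \<delta> i' = of_nat j))"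
proof -
  obtain a b where gen: "\<And>p. p \<in> annihilator \<longleftrightarrow> [:0, 1:] ^ a * [:-1, 1:] ^ b dvd p"
    using annihilator_generator by blast
  from eigenvalue_cases[OF gen assms] show ?thesis
  proof
    assume "\<delta> i = 0"
    then show ?thesis by (intro exI[of _ 0]) simp
  next
    assume "\<exists>l<b. \<delta> i = of_nat l"
    then show ?thesis using eigenvalue_attained[OF gen] by (meson le_less_trans)
  qed
qed

end

section \<open>Functionals given by their values on monomials\<close>

text \<open>The linear functional on polynomials that takes the value $f(k)$ on $t^k$.\<close>

definition linear_ext :: "(nat \<Rightarrow> 'a::field_char_0) \<Rightarrow> 'a poly \<Rightarrow> 'a" where
  "linear_ext f p = (\<Sum>k\<le>degree p. coeff p k * f k)"

lemma linear_ext_sum: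
  assumes "degree p \<le> N"
  shows "linear_ext f p = (\<Sum>k\<le>N. coeff p k * f k)"
  unfolding linear_ext_def using assms
  by (intro sum.mono_neutral_left) (auto simp: coeff_eq_0)

lemma linear_ext_add: "linear_ext f (p + q) = linear_ext f p + linear_ext f q"
proof -
  define N where "N = max (degree p) (degree q)"
  show ?thesis
    by (subst (1 2 3) linear_ext_sum[of _ N])
      (auto simp: N_def degree_add_le sum.distrib algebra_simps)
qed

lemma linear_ext_smult: "linear_ext f (smult u p) = u * linear_ext f p"
  by (subst linear_ext_sum[of _ "degree p"])
    (auto simp: linear_ext_def sum_distrib_left degree_smult_le algebra_simps)

lemma linear_ext_diff: "linear_ext f (p - q) = linear_ext f p - linear_ext f q"
  using linear_ext_add[of f "p - q" q] by simp

lemma linear_ext_pCons: "linear_ext f (pCons u p) = u * f 0 + linear_ext (\<lambda>k. f (Suc k)) p"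
  by (subst linear_ext_sum[of _ "Suc (degree p)"])
    (auto simp: linear_ext_def degree_pCons_le sum.atMost_Suc_shift simp del: sum.atMost_Suc)

lemma linear_ext_add_fun: "linear_ext (\<lambda>k. f k + g k) p = linear_ext f p + linear_ext g p"
  by (simp add: linear_ext_def sum.distrib algebra_simps)

lemma linear_ext_mult_fun: "linear_ext (\<lambda>k. u * f k) p = u * linear_ext f p"
  by (simp add: linear_ext_def sum_distrib_left algebra_simps)

lemma linear_ext_sum_fun: "linear_ext (\<lambda>k. \<Sum>x\<in>S. f x k) p = (\<Sum>x\<in>S. linear_ext (f x) p)"
  unfolding linear_ext_def sum_distrib_left by (rule sum.swap)

lemma linear_ext_pderiv: "linear_ext f (pderiv p) = linear_ext (\<lambda>k. of_nat k * f (k - 1)) p"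
proof (induction p arbitrary: f)
  case 0
  show ?case by (simp add: linear_ext_def)
next
  case (pCons u p)
  have "linear_ext f (pderiv (pCons u p)) =
      linear_ext f p + linear_ext (\<lambda>k. of_nat k * f (Suc (k - 1))) p"
    by (simp add: pderiv_pCons linear_ext_add linear_ext_pCons pCons.IH)
  also have "\<dots> = linear_ext (\<lambda>k. f k + of_nat k * f (Suc (k - 1))) p"
    by (rule linear_ext_add_fun[symmetric])
  also have "(\<lambda>k. f k + of_nat k * f (Suc (k - 1))) = (\<lambda>k. of_nat (Suc k) * f (Suc k - 1))"
  proof
    fix k
    show "f k + of_nat k * f (Suc (k - 1)) = of_nat (Suc k) * f (Suc k - 1)"
      by (cases k) (simp_all add: algebra_simps)
  qed
  finally show ?case by (simp add: linear_ext_pCons)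
qed

text \<open>
  The assumption is the eigenvector equation on monomials, as $\Delta t^k = k(t^{k+2} - t^{k+1})$.
\<close>

lemma linear_ext_cubic_deriv:
  assumes "\<And>k. of_nat k * (f (k + 2) - f (k + 1)) = e * f k"
  shows "linear_ext f (cubic_deriv p) = e * linear_ext f p"
proof -
  have "cubic_deriv p = pCons 0 (pCons 0 (pCons 0 (pderiv p) - pderiv p))"
    by (simp add: cubic_deriv_def power2_eq_square)
  then have "linear_ext f (cubic_deriv p) =
      linear_ext (\<lambda>k. f (k + 3)) (pderiv p) + linear_ext (\<lambda>k. - 1 * f (k + 2)) (pderiv p)"
    unfolding linear_ext_mult_fun by (simp add: linear_ext_pCons linear_ext_diff eval_nat_numeral)
  also have "\<dots> = linear_ext (\<lambda>k. of_nat k * (f (k - 1 + 3) + - 1 * f (k - 1 + 2))) p"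
    unfolding linear_ext_add_fun[symmetric] linear_ext_pderiv distrib_left ..
  also have "(\<lambda>k. of_nat k * (f (k - 1 + 3) + - 1 * f (k - 1 + 2))) = (\<lambda>k. e * f k)"
  proof
    fix k
    show "of_nat k * (f (k - 1 + 3) + - 1 * f (k - 1 + 2)) = e * f k"
      using assms[of k] by (cases k) (simp_all add: eval_nat_numeral)
  qed
  finally show ?thesis by (simp add: linear_ext_mult_fun)
qed

section \<open>Solutions of $YD - DY = Y^2 - Y^3$ with diagonal $D$\<close>

lemma index_mult_mat_sum:
  assumes "M \<in> carrier_mat n n" "N \<in> carrier_mat n n" "i < n" "j < n"
  shows "(M * N) $$ (i, j) = (\<Sum>x<n. M $$ (i, x) * N $$ (x, j))"
  using assms by (auto simp: scalar_prod_def lessThan_atLeast0 intro!: sum.cong)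

lemma pow_mat_carrier: "M \<in> carrier_mat n n \<Longrightarrow> M ^\<^sub>m k \<in> carrier_mat n n"
  by simp

lemma pow_mat_Suc_left:
  fixes M :: "'a::semiring_1 mat"
  assumes M: "M \<in> carrier_mat n n"
  shows "M ^\<^sub>m Suc k = M * M ^\<^sub>m k"
proof (induction k)
  case 0
  show ?case using M by simp
next
  case (Suc k)
  have "M ^\<^sub>m Suc (Suc k) = M * M ^\<^sub>m k * M" unfolding pow_mat.simps(2)[of M "Suc k"] Suc ..
  also have "\<dots> = M * M ^\<^sub>m Suc k"
    using M by (simp add: assoc_mult_mat[of _ n n _ n _ n])
  finally show ?case .
qed

lemma commutator_power:
  fixes Y D :: "'a::field_char_0 mat"
  assumes Y: "Y \<in> carrier_mat n n" and D: "D \<in> carrier_mat n n"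
    and eq: "Y * D - D * Y = Y ^\<^sub>m 2 - Y ^\<^sub>m 3"
  shows "Y ^\<^sub>m k * D - D * Y ^\<^sub>m k = of_nat k \<cdot>\<^sub>m (Y ^\<^sub>m (k + 1) - Y ^\<^sub>m (k + 2))"
proof (induction k)
  case 0
  show ?case using Y D by (auto intro!: eq_matI)
next
  case (Suc k)
  define Z where "Z = Y ^\<^sub>m k"
  have Z: "Z \<in> carrier_mat n n" using Y by (simp add: Z_def)
  have Z1: "Y ^\<^sub>m (k + 1) = Z * Y" and Z2: "Y ^\<^sub>m (k + 2) = Z * Y * Y"
    and Z3: "Y ^\<^sub>m (k + 3) = Z * Y * Y * Y"
    by (simp_all add: Z_def eval_nat_numeral)
  have Y2: "Y ^\<^sub>m 2 = Y * Y" and Y3: "Y ^\<^sub>m 3 = Y * Y * Y"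
    using Y by (simp_all add: eval_nat_numeral)
  note assoc = assoc_mult_mat[of _ n n _ n _ n]
  have "Z * Y * D - D * (Z * Y) = Z * (Y * D - D * Y) + (Z * D - D * Z) * Y"
  proof -
    have "Z * (Y * D - D * Y) = Z * Y * D - Z * D * Y"
      using Y D Z by (simp add: mult_minus_distrib_mat[of _ n n _ n] assoc)
    moreover have "(Z * D - D * Z) * Y = Z * D * Y - D * (Z * Y)"
      using Y D Z by (simp add: minus_mult_distrib_mat[of _ n n _ _ n] assoc)
    ultimately show ?thesis
      using Y D Z by (auto intro!: eq_matI)
  qed
  also have "\<dots> = Z * (Y * Y - Y * Y * Y) + (of_nat k \<cdot>\<^sub>m (Z * Y - Z * Y * Y)) * Y"
    using Suc unfolding eq Y2 Y3 Z1 Z2 Z_def[symmetric] by simp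
  also have "\<dots> = (Z * Y * Y - Z * Y * Y * Y) + of_nat k \<cdot>\<^sub>m (Z * Y * Y - Z * Y * Y * Y)"
  proof -
    have E: "Z * Y - Z * Y * Y \<in> carrier_mat n n" using Y Z by auto
    show ?thesis
      unfolding mult_smult_assoc_mat[OF E Y] using Y Z
      by (simp add: mult_minus_distrib_mat[of _ n n _ n] minus_mult_distrib_mat[of _ n n _ _ n] assoc)
  qed
  also have "\<dots> = of_nat (Suc k) \<cdot>\<^sub>m (Z * Y * Y - Z * Y * Y * Y)"
    using Y Z by (intro eq_matI) (auto simp: algebra_simps)
  finally show ?case
    using Z2 Z3 by (simp add: Z_def eval_nat_numeral)
qed

text \<open>
  $x$ is linked to $y$ in $S$ if $x = y + l$ for a natural number $l$ and
  $y, y + 1, \dots, y + l$ all lie in $S$.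
\<close>

definition linked :: "'a::semiring_1 set \<Rightarrow> 'a \<Rightarrow> 'a \<Rightarrow> bool" where
  "linked S x y \<longleftrightarrow> (\<exists>l. x = y + of_nat l \<and> (\<forall>j\<le>l. y + of_nat j \<in> S))"

lemma linked_refl: "x \<in> S \<Longrightarrow> linked S x x"
  unfolding linked_def by (rule exI[of _ 0]) simp

lemma linked_trans:
  assumes "linked S x y" "linked S y z"
  shows "linked S x z"
proof -
  obtain l m where l: "x = y + of_nat l" "\<And>j. j \<le> l \<Longrightarrow> y + of_nat j \<in> S"
    and m: "y = z + of_nat m" "\<And>j. j \<le> m \<Longrightarrow> z + of_nat j \<in> S"
    using assms unfolding linked_def by blast
  have "z + of_nat j \<in> S" if "j \<le> m + l" for j
  proof (cases "j \<le> m")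
    case False
    then have "z + of_nat j = y + of_nat (j - m)"
      unfolding m(1) add.assoc of_nat_add[symmetric] by simp
    then show ?thesis using l(2)[of "j - m"] that by simp
  qed (rule m(2))
  then show ?thesis unfolding linked_def l(1) m(1)
    by (intro exI[of _ "m + l"]) (simp add: add.assoc)
qed

lemma linked_antisym:
  fixes x y :: "'a::field_char_0"
  assumes "linked S x y" "linked S y x"
  shows "x = y"
proof -
  obtain l m where "x = y + of_nat l" "y = x + of_nat m"
    using assms unfolding linked_def by blast
  then have "of_nat (l + m) = (0::'a)" by (metis add.assoc add_cancel_right_right of_nat_add)
  then show ?thesis using \<open>x = y + of_nat l\<close> unfolding of_nat_eq_0_iff by simp
qed

lemma entries_linked:
  fixes Y :: "'a::{alg_closed_field, field_char_0} mat" and d :: "nat \<Rightarrow> 'a"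
  assumes Y: "Y \<in> carrier_mat n n"
    and eq: "Y * mat_diag n d - mat_diag n d * Y = Y ^\<^sub>m 2 - Y ^\<^sub>m 3"
    and i: "i < n" and j: "j < n" and nz: "Y $$ (i, j) \<noteq> 0"
  shows "linked (d ` {..<n}) (d i) (d j)"
proof -
  define f where "f x = (\<lambda>k. (Y ^\<^sub>m k) $$ (x, j))" for x
  note pc = pow_mat_carrier[OF Y]
  have rec: "of_nat k * (f x (k + 2) - f x (k + 1)) = (d x - d j) * f x k" if x: "x < n" for x k
  proof -
    have "(Y ^\<^sub>m k * mat_diag n d - mat_diag n d * Y ^\<^sub>m k) $$ (x, j) =
        (of_nat k \<cdot>\<^sub>m (Y ^\<^sub>m (k + 1) - Y ^\<^sub>m (k + 2))) $$ (x, j)"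
      using commutator_power[OF Y mat_diag_dim eq, of k] by (rule arg_cong)
    moreover have "(u \<cdot>\<^sub>m (P - Q)) $$ (x, j) = u * (P $$ (x, j) - Q $$ (x, j))"
      if "P \<in> carrier_mat n n" "Q \<in> carrier_mat n n" for u and P Q :: "'a mat"
      using that x j by simp
    ultimately have "f x k * d j - d x * f x k = of_nat k * (f x (k + 1) - f x (k + 2))"
      using x j pc[of k] pc[of "k + 1"] pc[of "k + 2"] unfolding f_def
      by (simp only: mat_diag_mult_left[OF pc] mat_diag_mult_right[OF pc]) (simp del: pow_mat.simps)
    then show ?thesis by (simp add: algebra_simps)
  qed
  have shift: "f x (Suc k) = (\<Sum>y<n. Y $$ (x, y) * f y k)" if "x < n" for x k
    unfolding f_def pow_mat_Suc_left[OF Y] using index_mult_mat_sum[OF Y pc that j] .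
  interpret cubic_eigenfunctionals "{..<n}" "\<lambda>x. linear_ext (f x)" "\<lambda>x. d x - d j"
  proof
    fix x p
    assume p: "\<And>y. y \<in> {..<n} \<Longrightarrow> linear_ext (f y) p = 0" and x: "x \<in> {..<n}"
    have "linear_ext (f x) (pCons 0 p) = linear_ext (\<lambda>k. \<Sum>y<n. Y $$ (x, y) * f y k) p"
      using x shift by (simp add: linear_ext_pCons)
    also have "\<dots> = 0" by (simp add: linear_ext_sum_fun linear_ext_mult_fun p)
    finally show "linear_ext (f x) (pCons 0 p) = 0" .
  qed (auto intro!: linear_ext_cubic_deriv rec simp: linear_ext_add linear_ext_smult)
  have "linear_ext (f i) [:0, 1:] = Y $$ (i, j)"
    using Y i j by (simp add: linear_ext_pCons f_def) (simp add: linear_ext_def)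
  with nz have "linear_ext (f i) [:0, 1:] \<noteq> 0" by simp
  from eigenvalue_chain[OF _ this] i obtain l
    where l: "d i - d j = of_nat l"
      and all: "\<forall>m\<le>l. m = 0 \<or> (\<exists>x\<in>{..<n}. d x - d j = of_nat m)" by auto
  have "d j + of_nat m \<in> d ` {..<n}" if m: "m \<le> l" for m
  proof (cases "m = 0")
    case False
    with all m obtain x where "x < n" "d x - d j = of_nat m" by auto
    then show ?thesis by (intro image_eqI[of _ _ x]) (auto simp: algebra_simps)
  qed (use j in auto)
  with l show ?thesis unfolding linked_def by (intro exI[of _ l]) (auto simp: algebra_simps)
qed

section \<open>Restriction to principal blocks\<close>

text \<open>
  The nonzero entries among the first $n$ rows and columns sit at positions that are related by $R$.
\<close>

definition supported_on :: "nat \<Rightarrow> (nat \<Rightarrow> nat \<Rightarrow> bool) \<Rightarrow> 'a::zero mat \<Rightarrow> bool" where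
  "supported_on n R M \<longleftrightarrow> (\<forall>i<n. \<forall>j<n. M $$ (i, j) \<noteq> 0 \<longrightarrow> R i j)"

lemma supported_on_mult:
  fixes M N :: "'a::semiring_0 mat"
  assumes "transp R" and M: "M \<in> carrier_mat n n" "supported_on n R M"
    and N: "N \<in> carrier_mat n n" "supported_on n R N"
  shows "supported_on n R (M * N)"
  unfolding supported_on_def
proof (intro allI impI)
  fix i j assume i: "i < n" and j: "j < n" and "(M * N) $$ (i, j) \<noteq> 0"
  then have "(\<Sum>x<n. M $$ (i, x) * N $$ (x, j)) \<noteq> 0"
    using index_mult_mat_sum[OF M(1) N(1) i j] by simp
  then obtain x where x: "x < n" and "M $$ (i, x) * N $$ (x, j) \<noteq> 0"
    by (auto elim: sum.not_neutral_contains_not_neutral)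
  then have "M $$ (i, x) \<noteq> 0" "N $$ (x, j) \<noteq> 0" by auto
  with x have "R i x" "R x j" using M(2) N(2) i j unfolding supported_on_def by auto
  then show "R i j" using \<open>transp R\<close> by (blast dest: transpD)
qed

text \<open>The square submatrix of size $m$ with rows and columns $s, \dots, s + m - 1$.\<close>

definition principal_block :: "nat \<Rightarrow> nat \<Rightarrow> 'a mat \<Rightarrow> 'a mat" where
  "principal_block s m M = mat m m (\<lambda>(i, j). M $$ (s + i, s + j))"

lemma principal_block_carrier [simp]: "principal_block s m M \<in> carrier_mat m m"
  by (simp add: principal_block_def)

lemma principal_block_dim [simp]:
  "dim_row (principal_block s m M) = m" "dim_col (principal_block s m M) = m"
  by (simp_all add: principal_block_def)

lemma principal_block_index [simp]:
  "i < m \<Longrightarrow> j < m \<Longrightarrow> principal_block s m M $$ (i, j) = M $$ (s + i, s + j)"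
  by (simp add: principal_block_def)

text \<open>
  If the interval of indices is convex for $R$, then no product of entries leaving and re-entering the
  block contributes to the block of $MN$.
\<close>

lemma principal_block_mult:
  fixes M N :: "'a::semiring_0 mat"
  assumes M: "M \<in> carrier_mat n n" "supported_on n R M"
    and N: "N \<in> carrier_mat n n" "supported_on n R N"
    and le: "s + m \<le> n"
    and convex: "\<And>i j x. i \<in> {s..<s + m} \<Longrightarrow> j \<in> {s..<s + m} \<Longrightarrow> x < n \<Longrightarrow>
      R i x \<Longrightarrow> R x j \<Longrightarrow> x \<in> {s..<s + m}"
  shows "principal_block s m (M * N) = principal_block s m M * principal_block s m N"
proof (rule eq_matI)
  fix i j
  assume "i < dim_row (principal_block s m M * principal_block s m N)"
    and "j < dim_col (principal_block s m M * principal_block s m N)"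
  then have i: "i < m" and j: "j < m" by (auto simp: principal_block_def)
  have "(M * N) $$ (s + i, s + j) = (\<Sum>x<n. M $$ (s + i, x) * N $$ (x, s + j))"
    using index_mult_mat_sum[OF M(1) N(1)] i j le by simp
  also have "\<dots> = (\<Sum>x\<in>{s..<s + m}. M $$ (s + i, x) * N $$ (x, s + j))"
  proof (rule sum.mono_neutral_right)
    show "\<forall>x\<in>{..<n} - {s..<s + m}. M $$ (s + i, x) * N $$ (x, s + j) = 0"
    proof (rule ballI, rule ccontr)
      fix x
      assume x: "x \<in> {..<n} - {s..<s + m}" and "M $$ (s + i, x) * N $$ (x, s + j) \<noteq> 0"
      then have "M $$ (s + i, x) \<noteq> 0" "N $$ (x, s + j) \<noteq> 0" by auto
      then have "R (s + i) x" "R x (s + j)"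
        using M(2) N(2) i j le x unfolding supported_on_def by auto
      with convex[of "s + i" "s + j" x] x i j show False by auto
    qed
  qed (use le in auto)
  also have "\<dots> = (\<Sum>x<m. M $$ (s + i, s + x) * N $$ (s + x, s + j))"
    by (rule sum.reindex_bij_witness[of _ "\<lambda>x. s + x" "\<lambda>x. x - s"]) auto
  also have "\<dots> = (principal_block s m M * principal_block s m N) $$ (i, j)"
    using i j by (subst index_mult_mat_sum[of _ m]) auto
  finally show "principal_block s m (M * N) $$ (i, j) =
      (principal_block s m M * principal_block s m N) $$ (i, j)"
    using i j by simp
qed (auto simp: principal_block_def)

lemma principal_block_equation:
  fixes Y D :: "'a::ring_1 mat"
  assumes Y: "Y \<in> carrier_mat n n" "supported_on n R Y"
    and D: "D \<in> carrier_mat n n" "supported_on n R D"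
    and R: "transp R"
    and eq: "Y * D - D * Y = Y ^\<^sub>m 2 - Y ^\<^sub>m 3"
    and le: "s + m \<le> n"
    and convex: "\<And>i j x. i \<in> {s..<s + m} \<Longrightarrow> j \<in> {s..<s + m} \<Longrightarrow> x < n \<Longrightarrow>
      R i x \<Longrightarrow> R x j \<Longrightarrow> x \<in> {s..<s + m}"
  shows "principal_block s m Y * principal_block s m D - principal_block s m D * principal_block s m Y
    = principal_block s m Y ^\<^sub>m 2 - principal_block s m Y ^\<^sub>m 3"
proof -
  let ?P = "principal_block s m"
  have minus: "?P (M - N) = ?P M - ?P N" if "M \<in> carrier_mat n n" "N \<in> carrier_mat n n"
    for M N :: "'a mat"
    using that le by (intro eq_matI) (auto simp: principal_block_def)
  have mult: "?P (M * N) = ?P M * ?P N" if "M \<in> carrier_mat n n" "supported_on n R M"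
    "N \<in> carrier_mat n n" "supported_on n R N" for M N :: "'a mat"
    by (rule principal_block_mult[OF that le]) (rule convex)
  have Y2: "Y * Y \<in> carrier_mat n n" "supported_on n R (Y * Y)"
    using Y supported_on_mult[OF R] by auto
  have pow: "M ^\<^sub>m 2 = M * M" "M ^\<^sub>m 3 = M * M * M" if "M \<in> carrier_mat l l"
    for M :: "'a mat" and l
    using that by (simp_all add: eval_nat_numeral)
  have "?P (Y * D - D * Y) = ?P (Y * Y - Y * Y * Y)" using eq pow[OF Y(1)] by simp
  moreover have "?P (Y * D - D * Y) = ?P Y * ?P D - ?P D * ?P Y"
    using Y D by (simp add: minus mult)
  moreover have "?P (Y * Y - Y * Y * Y) = ?P Y * ?P Y - ?P Y * ?P Y * ?P Y"
    using Y Y2 by (simp add: minus mult assoc_mult_mat[of _ m m _ m _ m])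
  ultimately show ?thesis unfolding pow[OF principal_block_carrier] by simp
qed

section \<open>Block-diagonal sums\<close>

lemma sum_list_take_le:
  "r < length xss \<Longrightarrow> sum_list (map length (take r xss)) + length (xss ! r) \<le> length (concat xss)"
proof (induction xss arbitrary: r)
  case (Cons xs xss)
  then show ?case by (cases r) auto
qed simp

lemma nth_concat_block:
  "p < length xss \<Longrightarrow> i < length (xss ! p) \<Longrightarrow>
    concat xss ! (sum_list (map length (take p xss)) + i) = xss ! p ! i"
proof (induction xss arbitrary: p)
  case (Cons xs xss)
  then show ?case by (cases p) (auto simp: nth_append add.assoc)
qed simp

lemma concat_index_split:
  assumes "x < length (concat xss)"
  obtains p i where "p < length xss" "i < length (xss ! p)"
    "x = sum_list (map length (take p xss)) + i"
proof -
  have "\<exists>p i. p < length xss \<and> i < length (xss ! p) \<and> x = sum_list (map length (take p xss)) + i"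
    using assms
  proof (induction xss arbitrary: x)
    case (Cons xs xss)
    show ?case
    proof (cases "x < length xs")
      case True
      then show ?thesis by (intro exI[of _ 0] exI[of _ x]) simp
    next
      case False
      with Cons.prems have "x - length xs < length (concat xss)" by simp
      from Cons.IH[OF this] obtain p i where "p < length xss" "i < length (xss ! p)"
        "x - length xs = sum_list (map length (take p xss)) + i" by blast
      with False show ?thesis by (intro exI[of _ "Suc p"] exI[of _ i]) simp
    qed
  qed simp
  with that show ?thesis by blast
qed

lemma diag_block_mat_index:
  assumes "\<forall>A\<in>set As. square_mat A" and "p < length As" "q < length As"
    and "i < dim_row (As ! p)" "j < dim_row (As ! q)"
  shows "diag_block_mat As $$
      (sum_list (map dim_row (take p As)) + i, sum_list (map dim_row (take q As)) + j) =
      (if p = q then As ! p $$ (i, j) else 0)"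
proof -
  have bound: "sum_list (map dim_row (take p As)) + i < sum_list (map dim_row As)"
    if "p < length As" "i < dim_row (As ! p)" for p i and As :: "'b mat list"
    using that
  proof (induction As arbitrary: p)
    case (Cons A As)
    then show ?case by (cases p) auto
  qed simp
  show ?thesis
    using assms
  proof (induction As arbitrary: p q)
    case (Cons A As)
    have sq: "dim_col A = dim_row A" using Cons.prems by simp
    have "square_mat (diag_block_mat As)" using Cons.prems by (intro diag_block_mat_square) auto
    then have dims: "dim_row (diag_block_mat As) = sum_list (map dim_row As)"
      "dim_col (diag_block_mat As) = sum_list (map dim_row As)"
      by (simp_all add: dim_diag_block_mat)
    show ?case
    proof (cases p; cases q)
      assume "p = 0" "q = 0"
      then show ?thesis using Cons.prems sq by (simp add: Let_def dims)
    next
      fix q' assume "p = 0" "q = Suc q'"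
      then show ?thesis using Cons.prems sq bound[of q' As j]
        by (simp add: Let_def dims add.assoc)
    next
      fix p' assume "p = Suc p'" "q = 0"
      then show ?thesis using Cons.prems sq bound[of p' As i]
        by (simp add: Let_def dims add.assoc)
    next
      fix p' q' assume "p = Suc p'" "q = Suc q'"
      then show ?thesis using Cons.prems sq bound[of p' As i] bound[of q' As j] Cons.IH[of p' q']
        by (simp add: Let_def dims add.assoc)
    qed
  qed simp
qed

lemma diag_block_mat_diag_of_list:
  "diag_block_mat (map diag_of_list xss) = diag_of_list (concat xss)"
proof (induction xss)
  case Nil
  show ?case by (auto simp: diag_of_list_def mat_diag_def)
next
  case (Cons xs xss)
  then show ?case
    by (intro eq_matI)
      (auto simp: Let_def diag_of_list_def mat_diag_def nth_append)
qed

lemma eq_diag_block_mat_principal_blocks: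
  fixes M :: "'a::zero mat"
  assumes M: "M \<in> carrier_mat (length (concat xss)) (length (concat xss))"
    and off: "\<And>p q i j. p < length xss \<Longrightarrow> q < length xss \<Longrightarrow> p \<noteq> q \<Longrightarrow>
      i < length (xss ! p) \<Longrightarrow> j < length (xss ! q) \<Longrightarrow>
      M $$ (sum_list (map length (take p xss)) + i, sum_list (map length (take q xss)) + j) = 0"
  shows "M = diag_block_mat (map
    (\<lambda>p. principal_block (sum_list (map length (take p xss))) (length (xss ! p)) M) [0..<length xss])"
    (is "M = diag_block_mat ?As")
proof -
  have sq: "\<forall>A\<in>set ?As. square_mat A" by (auto simp: principal_block_def)
  have rows: "map dim_row ?As = map length xss"
    by (rule nth_equalityI) (auto simp: principal_block_def)
  then have rows_take: "map dim_row (take p ?As) = map length (take p xss)" for p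
    by (metis take_map)
  have dims: "dim_row (diag_block_mat ?As) = length (concat xss)"
    using rows by (simp add: dim_diag_block_mat length_concat)
  moreover have "dim_col (diag_block_mat ?As) = length (concat xss)"
    using diag_block_mat_square[OF sq] dims by simp
  ultimately show ?thesis
  proof (intro eq_matI, goal_cases)
    case (1 x y)
    then have xy: "x < length (concat xss)" "y < length (concat xss)" by simp_all
    obtain p i where p: "p < length xss" "i < length (xss ! p)"
      and x: "x = sum_list (map length (take p xss)) + i"
      using concat_index_split[OF xy(1)] .
    obtain q j where q: "q < length xss" "j < length (xss ! q)"
      and y: "y = sum_list (map length (take q xss)) + j"
      using concat_index_split[OF xy(2)] .
    have "diag_block_mat ?As $$ (x, y) = (if p = q then ?As ! p $$ (i, j) else 0)"
    proof -
      have "dim_row (?As ! p) = length (xss ! p)" "dim_row (?As ! q) = length (xss ! q)"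
        using p q by (simp_all add: principal_block_def)
      then show ?thesis
        using diag_block_mat_index[OF sq, of p q i j] p q
        unfolding x y rows_take by simp
    qed
    also have "\<dots> = M $$ (x, y)"
      using p q off x y by auto
    finally show ?case by simp
  qed (use M in auto)
qed

section \<open>Decompositions of the spectrum\<close>

text \<open>
  Each list contains its values with their full multiplicity, so a value in two of the lists would occur
  too often in the spectrum.
\<close>

lemma spectrum_decomposition_disjoint:
  assumes A: "A \<in> carrier_mat n n" and dec: "spectrum_decomposition A k lam c B"
    and r: "r < k" and s: "s < k" and xr: "x \<in> set (B r)" and xs: "x \<in> set (B s)"
  shows "r = s"
proof (rule ccontr)
  assume "r \<noteq> s"
  define m where "m = order x (char_poly A)"
  have full: "m \<le> count (mset (B r)) x" "0 < m" if r: "r < k" and x: "x \<in> set (B r)" for r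
  proof -
    have "B r = concat (chain_lists A (lam r) (c r))"
      using dec r unfolding spectrum_decomposition_def chain_list_def by blast
    with x obtain xs where xs: "xs \<in> set (chain_lists A (lam r) (c r))" "x \<in> set xs"
      and Br: "B r = concat (chain_lists A (lam r) (c r))" by auto
    then obtain y where y: "xs = eigen_list A y" unfolding chain_lists_def by auto
    with xs(2) have rep: "xs = replicate m x" and "m \<noteq> 0"
      by (auto simp: eigen_list_def m_def)
    obtain us vs where "chain_lists A (lam r) (c r) = us @ xs # vs"
      using xs(1) by (meson split_list)
    then have "mset (B r) = mset (concat us) + replicate_mset m x + mset (concat vs)"
      unfolding Br by (simp add: rep)
    then have "m \<le> count (mset (B r)) x" by simp
    then show "m \<le> count (mset (B r)) x" "0 < m" using \<open>m \<noteq> 0\<close> by auto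
  qed
  have cp: "char_poly A \<noteq> 0" using degree_monic_char_poly[OF A] by auto
  have "m = count (\<Sum>r<k. mset (B r)) x"
    using dec cp unfolding spectrum_decomposition_def spectrum_mset_def m_def
    by (metis count_proots)
  also have "\<dots> = (\<Sum>r<k. count (mset (B r)) x)" by (rule count_sum)
  also have "\<dots> \<ge> (\<Sum>r\<in>{r, s}. count (mset (B r)) x)"
    using r s by (intro sum_mono2) auto
  also have "(\<Sum>r\<in>{r, s}. count (mset (B r)) x) = count (mset (B r)) x + count (mset (B s)) x"
    using \<open>r \<noteq> s\<close> by simp
  finally show False using full[OF r xr] full[OF s xs] by simp
qed

text \<open>
  Values in distinct lists never differ by $1$, so a chain of eigenvalues $y, y + 1, \dots, x$ stays in
  the list where it starts.
\<close>

lemma spectrum_decomposition_linked: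
  assumes dec: "spectrum_decomposition A k lam c B"
    and s: "s < k" and y: "y \<in> set (B s)" and xy: "linked (\<Union>r<k. set (B r)) x y"
  shows "x \<in> set (B s)"
proof -
  obtain l where l: "x = y + of_nat l" and mem: "\<And>j. j \<le> l \<Longrightarrow> y + of_nat j \<in> (\<Union>r<k. set (B r))"
    using xy unfolding linked_def by blast
  have "y + of_nat j \<in> set (B s)" if "j \<le> l" for j
    using that
  proof (induction j)
    case 0
    show ?case using y by simp
  next
    case (Suc j)
    then have prev: "y + of_nat j \<in> set (B s)" by simp
    obtain r where r: "r < k" "y + of_nat (Suc j) \<in> set (B r)" using mem[OF Suc.prems] by blast
    have "y + of_nat (Suc j) - (y + of_nat j) = 1" by simp
    with prev r s dec have "r = s" unfolding spectrum_decomposition_def by blast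
    with r show ?case by simp
  qed
  then show ?thesis unfolding l by blast
qed

section \<open>The block structure of the solution\<close>

theorem theorem1:
  fixes A X P Pinv :: "'a :: {alg_closed_field, field_char_0} mat"
    and n k :: nat
    and lam :: "nat \<Rightarrow> 'a" and c :: "nat \<Rightarrow> nat"
    and B :: "nat \<Rightarrow> 'a list" and U :: "nat \<Rightarrow> 'a mat"
  assumes A: "A \<in> carrier_mat n n" "diagonalizable_mat A"
    and X: "X \<in> carrier_mat n n" "X * A - A * X = X ^\<^sub>m 2 - X ^\<^sub>m 3"
    and B: "spectrum_decomposition A k lam c B"
    and U: "\<And>r. r < k \<Longrightarrow> U r = diag_of_list (B r)"
    and P: "P \<in> carrier_mat n n" "Pinv \<in> carrier_mat n n"
      "inverts_mat P Pinv" "inverts_mat Pinv P"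
    and PAP: "Pinv * A * P = diag_block_mat (map U [0..<k])"
  shows "\<exists>(Xb :: nat \<Rightarrow> 'a mat) (Y :: nat \<Rightarrow> nat \<Rightarrow> 'a mat).
    Pinv * X * P = diag_block_mat (map Xb [0..<k]) \<and>
    (\<forall>r<k.
      Xb r \<in> carrier_mat (length (B r)) (length (B r)) \<and>
      Xb r * U r - U r * Xb r = Xb r ^\<^sub>m 2 - Xb r ^\<^sub>m 3 \<and>
      (let ds = map length (chain_lists A (lam r) (c r)) in
        block_upper_triangular ds (Xb r) \<and>
        diag_blocks ds (Xb r) = map (Y r) (rev [0..<Suc (c r)])) \<and>
      (\<forall>i\<le>c r.
        Y r i \<in> carrier_mat (length (eigen_list A (lam r + of_nat i)))
                            (length (eigen_list A (lam r + of_nat i))) \<and>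
        Y r i ^\<^sub>m 2 - Y r i ^\<^sub>m 3 =
          0\<^sub>m (length (eigen_list A (lam r + of_nat i)))
              (length (eigen_list A (lam r + of_nat i)))))"
proof -
  \<comment> \<open>\<open>off r\<close> is the index at which the block of $B_r$ starts, and $R$ relates two indices
    if the corresponding eigenvalues are linked.\<close>
  define BL where "BL = map B [0..<k]"
  define d where "d x = concat BL ! x" for x
  define Y where "Y = Pinv * X * P"
  define D where "D = mat_diag n d"
  define off where "off r = sum_list (map length (take r BL))" for r
  define S where "S = (\<Union>r<k. set (B r))"
  define R where "R i j = linked S (d i) (d j)" for i j

  have BL [simp]: "length BL = k" "\<And>r. r < k \<Longrightarrow> BL ! r = B r" by (simp_all add: BL_def)
  have "map U [0..<k] = map diag_of_list BL" by (simp add: BL_def U)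
  then have PAP': "Pinv * A * P = diag_of_list (concat BL)"
    unfolding PAP by (simp only: diag_block_mat_diag_of_list)
  have "Pinv * A * P \<in> carrier_mat n n" using A(1) P(1,2) by simp
  then have len: "length (concat BL) = n"
    unfolding PAP' diag_of_list_def mat_diag_def
    by (auto dest: carrier_matD(1) simp only: dim_row_mat)
  have d_eq: "d = (\<lambda>x. concat BL ! x)" by (simp add: d_def fun_eq_iff)
  have D: "Pinv * A * P = D" unfolding PAP' D_def diag_of_list_def d_eq len ..
  have Dc: "D \<in> carrier_mat n n" by (simp add: D_def)
  have Yc: "Y \<in> carrier_mat n n" using X(1) P(1,2) by (simp add: Y_def)

  have conj_mult: "Pinv * (M * N) * P = (Pinv * M * P) * (Pinv * N * P)"
    if M: "M \<in> carrier_mat n n" and N: "N \<in> carrier_mat n n" for M N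
  proof -
    have PP: "P * Pinv = 1\<^sub>m n" using P(1,3) by (simp add: inverts_mat_def)
    have "(Pinv * M * P) * (Pinv * N * P) = Pinv * M * (P * Pinv) * N * P"
      using M N P(1,2) by (simp add: assoc_mult_mat[of _ n n _ n _ n])
    also have "\<dots> = Pinv * (M * N) * P"
      unfolding PP using M N P(1,2) by (simp add: assoc_mult_mat[of _ n n _ n _ n])
    finally show ?thesis by simp
  qed
  have conj_minus: "Pinv * (M - N) * P = Pinv * M * P - Pinv * N * P"
    if M: "M \<in> carrier_mat n n" and N: "N \<in> carrier_mat n n" for M N
  proof -
    have "Pinv * M \<in> carrier_mat n n" "Pinv * N \<in> carrier_mat n n" using M N P(2) by auto
    then show ?thesis
      by (simp add: mult_minus_distrib_mat[OF P(2) M N] minus_mult_distrib_mat[OF _ _ P(1)])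
  qed
  have pow: "M ^\<^sub>m 2 = M * M" "M ^\<^sub>m 3 = M * M * M" if "M \<in> carrier_mat n n" for M :: "'a mat"
    using that by (simp_all add: eval_nat_numeral)
  have XX: "X * A \<in> carrier_mat n n" "A * X \<in> carrier_mat n n" "X * X \<in> carrier_mat n n"
    "X * X * X \<in> carrier_mat n n" using A(1) X(1) by auto
  have eq: "Y * D - D * Y = Y ^\<^sub>m 2 - Y ^\<^sub>m 3"
  proof -
    have "Y * D - D * Y = Pinv * (X * A - A * X) * P"
      unfolding conj_minus[OF XX(1,2)] conj_mult[OF X(1) A(1)] conj_mult[OF A(1) X(1)]
      by (simp add: Y_def D)
    also have "\<dots> = Pinv * (X * X - X * X * X) * P" using X(2) pow[OF X(1)] by simp
    also have "\<dots> = Y * Y - Y * Y * Y"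
      unfolding conj_minus[OF XX(3,4)] conj_mult[OF XX(3) X(1)] conj_mult[OF X(1) X(1)]
      by (simp add: Y_def)
    finally show ?thesis using pow[OF Yc] by simp
  qed

  have dS: "d ` {..<n} = S"
  proof -
    have "d ` {..<n} = set (concat BL)" by (auto simp: set_conv_nth d_def len)
    also have "\<dots> = S" by (auto simp: BL_def S_def)
    finally show ?thesis .
  qed
  have R_trans: "transp R" unfolding R_def by (intro transpI) (rule linked_trans)
  have supp_Y: "supported_on n R Y"
    using entries_linked[OF Yc eq[unfolded D_def]] unfolding supported_on_def R_def dS by blast
  have supp_D: "supported_on n R D"
    unfolding supported_on_def D_def mat_diag_def R_def using dS by (auto intro!: linked_refl)

  have d_off: "d (off r + t) = B r ! t" if "r < k" "t < length (B r)" for r t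
    using nth_concat_block[of r BL t] that by (simp add: d_def off_def)
  have off_le: "off r + length (B r) \<le> n" if "r < k" for r
    using sum_list_take_le[of r BL] that by (simp add: off_def len)
  have in_block: "\<exists>t<length (B r). x = off r + t" if x: "x < n" "d x \<in> set (B r)" and r: "r < k" for x r
  proof -
    obtain s t where s: "s < k" and t: "t < length (B s)" and xt: "x = off s + t"
      using concat_index_split[of x BL] x(1) len unfolding off_def by (metis BL)
    then have "d x \<in> set (B s)" using d_off by simp
    then have "s = r" using spectrum_decomposition_disjoint[OF A(1) B s r] x(2) by blast
    with t xt show ?thesis by blast
  qed
  have linked_block: "d x \<in> set (B r)" if "R x y" "d y \<in> set (B r)" "r < k" for x y r
    using spectrum_decomposition_linked[OF B that(3,2)] that(1) unfolding R_def S_def by blast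

  define Xb where "Xb r = principal_block (off r) (length (B r)) Y" for r
  have Y_sum: "Y = diag_block_mat (map Xb [0..<k])"
  proof -
    have "Y = diag_block_mat (map (\<lambda>p. principal_block (sum_list (map length (take p BL)))
        (length (BL ! p)) Y) [0..<length BL])"
    proof (rule eq_diag_block_mat_principal_blocks)
      fix p q i j
      assume "p < length BL" "q < length BL" and pq: "p \<noteq> q"
        and "i < length (BL ! p)" "j < length (BL ! q)"
      then have p: "p < k" and q: "q < k" and i: "i < length (B p)" and j: "j < length (B q)"
        by simp_all
      have mem: "d (off p + i) \<in> set (B p)" "d (off q + j) \<in> set (B q)"
        using d_off p q i j by simp_all
      have "\<not> R (off p + i) (off q + j)"
        using linked_block[OF _ mem(2) q] mem(1) spectrum_decomposition_disjoint[OF A(1) B p q] pq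
        by blast
      moreover have "off p + i < n" "off q + j < n" using off_le[OF p] off_le[OF q] i j by simp_all
      ultimately have "Y $$ (off p + i, off q + j) = 0" using supp_Y unfolding supported_on_def by blast
      then show "Y $$ (sum_list (map length (take p BL)) + i, sum_list (map length (take q BL)) + j) = 0"
        by (simp add: off_def)
    qed (simp add: len Yc)
    also have "map (\<lambda>p. principal_block (sum_list (map length (take p BL))) (length (BL ! p)) Y)
        [0..<length BL] = map Xb [0..<k]"
      by (simp add: Xb_def off_def)
    finally show ?thesis .
  qed
  have Xb_eq: "Xb r * U r - U r * Xb r = Xb r ^\<^sub>m 2 - Xb r ^\<^sub>m 3" if r: "r < k" for r
  proof -
    have Ur: "U r = principal_block (off r) (length (B r)) D"
      unfolding U[OF r] diag_of_list_def D_def using off_le[OF r] d_off[OF r]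
      by (intro eq_matI) (auto simp: mat_diag_def principal_block_def)
    have convex: "x \<in> {off r..<off r + length (B r)}"
      if "i \<in> {off r..<off r + length (B r)}" and j: "j \<in> {off r..<off r + length (B r)}" and x: "x < n"
        and "R i x" and "R x j" for i j x
    proof -
      have "j - off r < length (B r)" "off r + (j - off r) = j" using j by auto
      then have "d j \<in> set (B r)" using d_off[OF r, of "j - off r"] by simp
      then have "d x \<in> set (B r)" using linked_block \<open>R x j\<close> r by blast
      from in_block[OF x this r] show ?thesis by auto
    qed
    show ?thesis unfolding Xb_def Ur
      by (rule principal_block_equation[OF Yc supp_Y Dc supp_D R_trans eq off_le[OF r]])
        (rule convex)
  qed

  \<comment> \<open>\<open>sub r p\<close> is the position in $B_r$ at which its list number $p$ starts. Counted from $0$, list $p$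
    consists of copies of $\lambda_r + (c_r - p)$, whence the index $c_r - i$ for $Y_{r,i}$.\<close>
  define CL where "CL r = chain_lists A (lam r) (c r)" for r
  define sub where "sub r p = sum_list (map length (take p (CL r)))" for r p
  define Yb where "Yb r i = principal_block (off r + sub r (c r - i)) (length (CL r ! (c r - i))) Y" for r i
  have CL_len [simp]: "length (CL r) = Suc (c r)" for r by (simp add: CL_def chain_lists_def)
  have CL_nth: "CL r ! p = eigen_list A (lam r + of_nat (c r - p))" if "p \<le> c r" for r p
    using that by (simp add: CL_def chain_lists_def rev_nth del: upt_Suc)
  have CL_mem: "CL r ! p ! t = lam r + of_nat (c r - p)" if "p \<le> c r" "t < length (CL r ! p)" for r p t
    using that by (simp add: CL_nth eigen_list_def)
  have B_CL: "B r = concat (CL r)" if "r < k" for r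
    using B that unfolding spectrum_decomposition_def chain_list_def CL_def by blast
  have sub_lt: "sub r p + length (CL r ! p) \<le> length (B r)" if "r < k" "p \<le> c r" for r p
    using sum_list_take_le[of p "CL r"] that by (simp add: sub_def B_CL)
  have d_sub: "d (off r + sub r p + t) = lam r + of_nat (c r - p)"
    if "r < k" "p \<le> c r" "t < length (CL r ! p)" for r p t
  proof -
    have "B r ! (sub r p + t) = CL r ! p ! t"
      unfolding B_CL[OF that(1)] sub_def using that by (intro nth_concat_block) auto
    then show ?thesis
      using d_off[OF that(1), of "sub r p + t"] sub_lt[OF that(1,2)] that CL_mem by (simp add: add.assoc)
  qed
  have upper: "block_upper_triangular (map length (CL r)) (Xb r)" if r: "r < k" for r
    unfolding block_upper_triangular_def
  proof (intro conjI allI impI)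
    show "Xb r \<in> carrier_mat (sum_list (map length (CL r))) (sum_list (map length (CL r)))"
      by (simp add: Xb_def B_CL[OF r] length_concat)
    fix p q assume "p < length (map length (CL r))" and qp: "q < p"
    then have p: "p \<le> c r" and q: "q \<le> c r" by auto
    have "Xb r $$ (sub r p + i, sub r q + j) = 0"
      if i: "i < length (CL r ! p)" and j: "j < length (CL r ! q)" for i j
    proof -
      have "\<not> R (off r + sub r p + i) (off r + sub r q + j)"
      proof
        assume "R (off r + sub r p + i) (off r + sub r q + j)"
        then obtain l where "lam r + of_nat (c r - p) = lam r + of_nat (c r - q) + of_nat l"
          unfolding R_def linked_def d_sub[OF r p i] d_sub[OF r q j] by blast
        then have "of_nat (c r - p) = (of_nat (c r - q + l) :: 'a)" by (simp add: add.assoc)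
        then have "c r - p = c r - q + l" unfolding of_nat_eq_iff .
        with qp p show False by simp
      qed
      moreover have "off r + sub r p + i < n" "off r + sub r q + j < n"
        using off_le[OF r] sub_lt[OF r p] sub_lt[OF r q] i j by simp_all
      ultimately have "Y $$ (off r + sub r p + i, off r + sub r q + j) = 0"
        using supp_Y unfolding supported_on_def by blast
      then show ?thesis
        using sub_lt[OF r p] sub_lt[OF r q] i j by (simp add: Xb_def add.assoc)
    qed
    then show "mat_block (map length (CL r)) (Xb r) p q = 0\<^sub>m (map length (CL r) ! p) (map length (CL r) ! q)"
      using p q by (intro eq_matI) (auto simp: mat_block_def sub_def take_map)
  qed
  have diag: "diag_blocks (map length (CL r)) (Xb r) = map (Yb r) (rev [0..<Suc (c r)])"
    if r: "r < k" for r
  proof (rule nth_equalityI)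
    fix p assume "p < length (diag_blocks (map length (CL r)) (Xb r))"
    then have p: "p \<le> c r" by (simp add: diag_blocks_def)
    have "diag_blocks (map length (CL r)) (Xb r) ! p = mat_block (map length (CL r)) (Xb r) p p"
      using p by (simp add: diag_blocks_def del: upt_Suc)
    also have "\<dots> = Yb r (c r - p)"
      using p sub_lt[OF r p]
      by (intro eq_matI) (auto simp: mat_block_def Yb_def Xb_def take_map add.assoc simp flip: sub_def)
    also have "\<dots> = map (Yb r) (rev [0..<Suc (c r)]) ! p"
      using p by (simp add: rev_nth del: upt_Suc)
    finally show "diag_blocks (map length (CL r)) (Xb r) ! p = map (Yb r) (rev [0..<Suc (c r)]) ! p" .
  qed (simp add: diag_blocks_def)
  have Yb_eq: "Yb r i ^\<^sub>m 2 - Yb r i ^\<^sub>m 3 =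
      0\<^sub>m (length (eigen_list A (lam r + of_nat i))) (length (eigen_list A (lam r + of_nat i)))"
    if r: "r < k" and i: "i \<le> c r" for r i
  proof -
    define p where "p = c r - i"
    define o' where "o' = off r + sub r p"
    define m where "m = length (CL r ! p)"
    have p: "p \<le> c r" "c r - p = i" using i by (auto simp: p_def)
    have m: "m = length (eigen_list A (lam r + of_nat i))" using CL_nth[OF p(1)] p(2) by (simp add: m_def)
    have d_const: "d (o' + t) = lam r + of_nat i" if "t < m" for t
      using d_sub[OF r p(1)] that p(2) by (simp add: o'_def m_def)
    have le: "o' + m \<le> n" using off_le[OF r] sub_lt[OF r p(1)] by (simp add: o'_def m_def)
    \<comment> \<open>By antisymmetry an index between two indices of the block carries the same eigenvalue.\<close>
    have convex: "x \<in> {o'..<o' + m}"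
      if a: "a \<in> {o'..<o' + m}" and b: "b \<in> {o'..<o' + m}" and x: "x < n"
        and ax: "R a x" and xb: "R x b" for a b x
    proof -
      have ab: "d a = lam r + of_nat i" "d b = lam r + of_nat i"
        using d_const[of "a - o'"] d_const[of "b - o'"] a b by auto
      have dx: "d x = lam r + of_nat i"
        using linked_antisym[of S "d x" "lam r + of_nat i"] ax xb unfolding R_def ab by blast
      have "b - off r < length (B r)" "off r + (b - off r) = b"
        using b sub_lt[OF r p(1)] by (auto simp: o'_def m_def)
      then have "d b \<in> set (B r)" using d_off[OF r, of "b - off r"] by simp
      then have "d x \<in> set (B r)" unfolding dx ab .
      from in_block[OF x this r] obtain t where t: "t < length (B r)" "x = off r + t" by blast
      obtain q u where q: "q < length (CL r)" "u < length (CL r ! q)" and u: "t = sub r q + u"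
        using concat_index_split[of t "CL r"] t(1) B_CL[OF r] unfolding sub_def by metis
      have "d x = lam r + of_nat (c r - q)"
        using d_sub[OF r _ q(2)] q(1) u t(2) by (simp add: add.assoc)
      then have "c r - q = c r - p" using dx p(2) by simp
      then have "q = p" using q(1) p(1) by simp
      then show ?thesis using t(2) u q(2) by (simp add: o'_def m_def)
    qed
    have "principal_block o' m D = mat_diag m (\<lambda>_. lam r + of_nat i)"
      using le d_const by (intro eq_matI) (auto simp: D_def mat_diag_def principal_block_def)
    moreover have "principal_block o' m Y * principal_block o' m D
        - principal_block o' m D * principal_block o' m Y
        = principal_block o' m Y ^\<^sub>m 2 - principal_block o' m Y ^\<^sub>m 3"
      by (rule principal_block_equation[OF Yc supp_Y Dc supp_D R_trans eq le]) (rule convex)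
    moreover have Yb: "Yb r i = principal_block o' m Y"
      unfolding Yb_def p_def[symmetric] m_def o'_def ..
    ultimately have "Yb r i ^\<^sub>m 2 - Yb r i ^\<^sub>m 3 =
        Yb r i * mat_diag m (\<lambda>_. lam r + of_nat i) - mat_diag m (\<lambda>_. lam r + of_nat i) * Yb r i"
      by simp
    also have "\<dots> = 0\<^sub>m m m"
      unfolding Yb mat_diag_mult_left[OF principal_block_carrier]
        mat_diag_mult_right[OF principal_block_carrier]
      by (intro eq_matI) auto
    finally show ?thesis unfolding m .
  qed
  have Yb_c: "Yb r i \<in> carrier_mat (length (eigen_list A (lam r + of_nat i)))
      (length (eigen_list A (lam r + of_nat i)))" if "i \<le> c r" for r i
    using CL_nth[of "c r - i" r] that by (simp add: Yb_def)
  show ?thesis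
  proof (intro exI[of _ Xb] exI[of _ Yb] conjI allI impI)
    show "Pinv * X * P = diag_block_mat (map Xb [0..<k])" using Y_sum by (simp add: Y_def)
  next
    fix r assume r: "r < k"
    show "let ds = map length (chain_lists A (lam r) (c r)) in
        block_upper_triangular ds (Xb r) \<and>
        diag_blocks ds (Xb r) = map (Yb r) (rev [0..<Suc (c r)])"
      using upper[OF r] diag[OF r] unfolding CL_def Let_def by blast
  qed (simp_all add: Xb_eq Yb_eq Yb_c, simp add: Xb_def)
qed

end
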